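(* Let $\mathfrak{sv}$ be the Schrödinger-Virasoro algebra over $\mathbb{C}$. For every integer $N\ge3$, $$\mathrm{Der}^{(N)}(\mathfrak{sv})=\mathrm{Der}(\mathfrak{sv}).$$
   Context: The Schrödinger-Virasoro algebra $\mathfrak{sv}$ is the complex Lie algebra with $\mathbb{C}$-basis $\{L_n,M_n,Y_{n+\frac12},C\mid n\in\mathbb{Z}\}$ and brackets, for $m,n\in\mathbb{Z}$, $$[L_m,L_n]=(n-m)L_{n+m}+\delta_{m+n,0}\tfrac{n^3-n}{12}C,\quad [L_m,M_n]=nM_{n+m},$$ $$[L_m,Y_{n+\frac12}]=\left(n+\tfrac{1-m}{2}\right)Y_{m+n+\frac12},\quad [Y_{m+\frac12},Y_{n+\frac12}]=(n-m)M_{m+n+1},$$ $$[M_m,M_n]=[M_m,Y_{n+\frac12}]=0,\quad [\mathfrak{sv},C]=\{0\}.$$ For elements of a Lie algebra $\mathcal{L}$ write $[x_1,\dots,x_N]=[x_1,[x_2,\cdots[x_{N-2},[x_{N-1},x_N]]\cdots]]$. An $N$-derivation of $\mathcal{L}$ is a linear map $\varphi:\mathcal{L}\to\mathcal{L}$ with $\varphi([x_1,\dots,x_N])=\sum_{i=1}^N[x_1,\dots,x_{i-1},\varphi(x_i),x_{i+1},\dots,x_N]$ for all $x_1,\dots,x_N\in\mathcal{L}$; $\mathrm{Der}^{(N)}(\mathcal{L})$ is the set of all $N$-derivations and $\mathrm{Der}(\mathcal{L})$ the set of all derivations of $\mathcal{L}$. *)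

theory Defs
  imports Complex_Main "HOL-Library.Poly_Mapping"
begin

section \<open>Lie algebras, derivations and N-derivations\<close>

locale lie_algebra = vector_space scale
  for scale :: "'k::field \<Rightarrow> 'v::ab_group_add \<Rightarrow> 'v" +
  fixes bracket :: "'v \<Rightarrow> 'v \<Rightarrow> 'v"
  assumes bracket_add_left: "bracket (x + y) z = bracket x z + bracket y z"
    and bracket_add_right: "bracket x (y + z) = bracket x y + bracket x z"
    and bracket_scale_left: "bracket (scale c x) y = scale c (bracket x y)"
    and bracket_scale_right: "bracket x (scale c y) = scale c (bracket x y)"
    and bracket_self: "bracket x x = 0"
    and jacobi: "bracket x (bracket y z) + bracket y (bracket z x) + bracket z (bracket x y) = 0"
begin

text \<open>The right-nested bracket \<open>[x\<^sub>1, [x\<^sub>2, \<dots> [x\<^bsub>N-1\<^esub>, x\<^sub>N] \<dots>]]\<close>;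
  the value on the empty list is irrelevant.\<close>

primrec iterated_bracket :: "'v list \<Rightarrow> 'v" where
  "iterated_bracket [] = 0"
| "iterated_bracket (x # xs) = (if xs = [] then x else bracket x (iterated_bracket xs))"

definition is_derivation :: "('v \<Rightarrow> 'v) \<Rightarrow> bool" where
  "is_derivation \<phi> \<longleftrightarrow>
     Vector_Spaces.linear scale scale \<phi> \<and>
     (\<forall>x y. \<phi> (bracket x y) = bracket (\<phi> x) y + bracket x (\<phi> y))"

definition is_N_derivation :: "nat \<Rightarrow> ('v \<Rightarrow> 'v) \<Rightarrow> bool" where
  "is_N_derivation N \<phi> \<longleftrightarrow>
     Vector_Spaces.linear scale scale \<phi> \<and>
     (\<forall>xs. length xs = N \<longrightarrow>
        \<phi> (iterated_bracket xs) = (\<Sum>i<N. iterated_bracket (xs[i := \<phi> (xs ! i)])))"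

definition Der :: "('v \<Rightarrow> 'v) set" where
  "Der = {\<phi>. is_derivation \<phi>}"

definition Der_N :: "nat \<Rightarrow> ('v \<Rightarrow> 'v) set" where
  "Der_N N = {\<phi>. is_N_derivation N \<phi>}"

end

section \<open>The Schroedinger-Virasoro algebra\<close>

text \<open>\<open>Yb n\<close> stands for the basis vector with half-integer index \<open>n + 1/2\<close>.\<close>

datatype sv_basis = Lb int | Mb int | Yb int | Cb

text \<open>Finitely supported complex coefficient functions on the basis.\<close>

type_synonym sv = "sv_basis \<Rightarrow>\<^sub>0 complex"

definition sv_scale :: "complex \<Rightarrow> sv \<Rightarrow> sv" where
  "sv_scale c x = Poly_Mapping.map ((*) c) x"

text \<open>The clauses for \<open>[M, L]\<close> and \<open>[Y, L]\<close> are the ones forced by antisymmetry; in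
  \<open>[Y\<^bsub>m+1/2\<^esub>, Y\<^bsub>n+1/2\<^esub>] = (n - m) M\<^bsub>m+n+1\<^esub>\<close> the index is the sum of the
  half-integer indices.\<close>

fun sv_basis_bracket :: "sv_basis \<Rightarrow> sv_basis \<Rightarrow> sv" where
  "sv_basis_bracket (Lb m) (Lb n) =
     Poly_Mapping.single (Lb (m + n)) (of_int (n - m)) +
     (if m + n = 0 then Poly_Mapping.single Cb (of_int (n ^ 3 - n) / 12) else 0)"
| "sv_basis_bracket (Lb m) (Mb n) = Poly_Mapping.single (Mb (m + n)) (of_int n)"
| "sv_basis_bracket (Mb n) (Lb m) = - Poly_Mapping.single (Mb (m + n)) (of_int n)"
| "sv_basis_bracket (Lb m) (Yb n) =
     Poly_Mapping.single (Yb (m + n)) (of_int n + (1 - of_int m) / 2)"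
| "sv_basis_bracket (Yb n) (Lb m) =
     - Poly_Mapping.single (Yb (m + n)) (of_int n + (1 - of_int m) / 2)"
| "sv_basis_bracket (Yb m) (Yb n) = Poly_Mapping.single (Mb (m + n + 1)) (of_int (n - m))"
| "sv_basis_bracket (Mb m) (Mb n) = 0"
| "sv_basis_bracket (Mb m) (Yb n) = 0"
| "sv_basis_bracket (Yb n) (Mb m) = 0"
| "sv_basis_bracket Cb b = 0"
| "sv_basis_bracket b Cb = 0"

definition sv_bracket :: "sv \<Rightarrow> sv \<Rightarrow> sv" where
  "sv_bracket x y =
     (\<Sum>a\<in>Poly_Mapping.keys x. \<Sum>b\<in>Poly_Mapping.keys y.
        sv_scale (Poly_Mapping.lookup x a * Poly_Mapping.lookup y b) (sv_basis_bracket a b))"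

lemma lookup_sv_scale [simp]:
  "Poly_Mapping.lookup (sv_scale c x) a = c * Poly_Mapping.lookup x a"
  by (simp add: sv_scale_def map.rep_eq when_def)

lemma vector_space_sv: "vector_space sv_scale"
  by unfold_locales (auto intro!: poly_mapping_eqI simp: lookup_add algebra_simps)

interpretation sv_vs: vector_space sv_scale
  by (rule vector_space_sv)

lemma sv_scale_single [simp]:
  "sv_scale c (Poly_Mapping.single a d) = Poly_Mapping.single a (c * d)"
  by (rule poly_mapping_eqI) (simp add: lookup_single when_def)

lemma sv_bracket_superset:
  assumes "finite A" "Poly_Mapping.keys x \<subseteq> A" "finite B" "Poly_Mapping.keys y \<subseteq> B"
  shows "sv_bracket x y = (\<Sum>a\<in>A. \<Sum>b\<in>B.
     sv_scale (Poly_Mapping.lookup x a * Poly_Mapping.lookup y b) (sv_basis_bracket a b))"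
proof -
  have inner: "(\<Sum>b\<in>Poly_Mapping.keys y.
        sv_scale (Poly_Mapping.lookup x a * Poly_Mapping.lookup y b) (sv_basis_bracket a b)) =
      (\<Sum>b\<in>B. sv_scale (Poly_Mapping.lookup x a * Poly_Mapping.lookup y b) (sv_basis_bracket a b))"
    for a
    by (rule sum.mono_neutral_left) (use assms in \<open>auto simp: in_keys_iff\<close>)
  show ?thesis
    unfolding sv_bracket_def inner
    by (rule sum.mono_neutral_left) (use assms in \<open>auto simp: in_keys_iff\<close>)
qed

lemma keys_sv_scale: "Poly_Mapping.keys (sv_scale c x) \<subseteq> Poly_Mapping.keys x"
  by (auto simp: in_keys_iff)

lemma sv_bracket_add_left: "sv_bracket (x + y) z = sv_bracket x z + sv_bracket y z"
proof -
  let ?A = "Poly_Mapping.keys x \<union> Poly_Mapping.keys y" and ?B = "Poly_Mapping.keys z"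
  have "sv_bracket w z = (\<Sum>a\<in>?A. \<Sum>b\<in>?B.
      sv_scale (Poly_Mapping.lookup w a * Poly_Mapping.lookup z b) (sv_basis_bracket a b))"
    if "Poly_Mapping.keys w \<subseteq> ?A" for w
    using that by (intro sv_bracket_superset) auto
  from this[of x] this[of y] this[of "x + y"] show ?thesis
    using Poly_Mapping.keys_add[of x y]
    by (simp add: lookup_add distrib_right sv_vs.scale_left_distrib sum.distrib)
qed

lemma sv_bracket_add_right: "sv_bracket z (x + y) = sv_bracket z x + sv_bracket z y"
proof -
  let ?A = "Poly_Mapping.keys x \<union> Poly_Mapping.keys y" and ?B = "Poly_Mapping.keys z"
  have "sv_bracket z w = (\<Sum>a\<in>?B. \<Sum>b\<in>?A.
      sv_scale (Poly_Mapping.lookup z a * Poly_Mapping.lookup w b) (sv_basis_bracket a b))"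
    if "Poly_Mapping.keys w \<subseteq> ?A" for w
    using that by (intro sv_bracket_superset) auto
  from this[of x] this[of y] this[of "x + y"] show ?thesis
    using Poly_Mapping.keys_add[of x y]
    by (simp add: lookup_add distrib_left sv_vs.scale_left_distrib sum.distrib)
qed

lemma sv_bracket_scale_left: "sv_bracket (sv_scale c x) y = sv_scale c (sv_bracket x y)"
  by (subst sv_bracket_superset[OF finite_keys keys_sv_scale finite_keys order_refl])
     (simp add: sv_bracket_def sv_vs.scale_sum_right mult.assoc)

lemma sv_bracket_scale_right: "sv_bracket x (sv_scale c y) = sv_scale c (sv_bracket x y)"
  by (subst sv_bracket_superset[OF finite_keys order_refl finite_keys keys_sv_scale])
     (simp add: sv_bracket_def sv_vs.scale_sum_right mult.left_commute)

lemma sv_bracket_zero [simp]: "sv_bracket 0 x = 0" "sv_bracket x 0 = 0"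
  by (simp_all add: sv_bracket_def)

lemma sv_bracket_minus [simp]:
  "sv_bracket (- x) y = - sv_bracket x y" "sv_bracket x (- y) = - sv_bracket x y"
  using sv_bracket_add_left[of "- x" x y] sv_bracket_add_right[of x "- y" y]
  by (simp_all add: eq_neg_iff_add_eq_0)

lemma sv_bracket_single [simp]:
  "sv_bracket (Poly_Mapping.single a c) (Poly_Mapping.single b d) =
     sv_scale (c * d) (sv_basis_bracket a b)"
  by (subst sv_bracket_superset[where A = "{a}" and B = "{b}"]) auto

lemma sv_induct [case_names zero single add]:
  fixes x :: sv
  assumes "P 0" "\<And>a c. P (Poly_Mapping.single a c)" "\<And>x y. P x \<Longrightarrow> P y \<Longrightarrow> P (x + y)"
  shows "P x"
proof (induction x rule: update_induct)
  case const
  show ?case by (rule assms(1))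
next
  case (update f a b)
  have "Poly_Mapping.update a b f = f + Poly_Mapping.single a b"
    using update.hyps
    by (intro poly_mapping_eqI)
       (auto simp: lookup_update lookup_add lookup_single when_def in_keys_iff)
  then show ?case
    using update assms(2,3) by metis
qed

lemma sv_basis_bracket_swap: "sv_basis_bracket b a = - sv_basis_bracket a b"
proof -
  have eq: "m + n = 0 \<Longrightarrow>
      Poly_Mapping.single Cb (of_int (m ^ 3 - m) / 12 :: complex) =
      - Poly_Mapping.single Cb (of_int (n ^ 3 - n) / 12)" for m n :: int
  proof -
    assume "m + n = 0"
    then have m: "m = - n" by simp
    show ?thesis by (simp add: m single_uminus[symmetric] minus_divide_left)
  qed
  have single_diff_swap: "Poly_Mapping.single k (of_int (m - n) :: complex) =
      - Poly_Mapping.single k (of_int (n - m))" for k :: sv_basis and m n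
    by (simp add: single_uminus[symmetric])
  show ?thesis
  proof (cases a; cases b)
    fix m n assume [simp]: "a = Lb m" "b = Lb n"
    show ?thesis
      using eq[of n m] single_diff_swap[of _ m n] by (auto simp: add.commute)
  next
    fix m n assume [simp]: "a = Yb m" "b = Yb n"
    show ?thesis
      using single_diff_swap[of _ m n] by (simp add: add.commute)
  qed simp_all
qed

lemma sv_bracket_swap: "sv_bracket y x = - sv_bracket x y"
proof -
  have "sv_bracket y x = (\<Sum>a\<in>Poly_Mapping.keys x. \<Sum>b\<in>Poly_Mapping.keys y.
      sv_scale (Poly_Mapping.lookup y b * Poly_Mapping.lookup x a) (sv_basis_bracket b a))"
    unfolding sv_bracket_def by (rule sum.swap)
  also have "\<dots> = (\<Sum>a\<in>Poly_Mapping.keys x. \<Sum>b\<in>Poly_Mapping.keys y.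
      - sv_scale (Poly_Mapping.lookup x a * Poly_Mapping.lookup y b) (sv_basis_bracket a b))"
    by (intro sum.cong refl) (metis mult.commute sv_basis_bracket_swap sv_vs.scale_minus_right)
  finally show ?thesis
    by (simp add: sv_bracket_def sum_negf)
qed

lemma sv_bracket_self: "sv_bracket x x = 0"
proof (rule poly_mapping_eqI)
  fix k
  have "Poly_Mapping.lookup (sv_bracket x x) k = - Poly_Mapping.lookup (sv_bracket x x) k"
    using arg_cong[OF sv_bracket_swap[of x x], of "\<lambda>p. Poly_Mapping.lookup p k"] by simp
  then show "Poly_Mapping.lookup (sv_bracket x x) k = Poly_Mapping.lookup 0 k"
    by simp
qed

lemma sv_jacobi_basis:
  defines "e \<equiv> \<lambda>a. Poly_Mapping.single a (1::complex)"
  shows "sv_bracket (e a) (sv_bracket (e b) (e c)) + sv_bracket (e b) (sv_bracket (e c) (e a)) +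
    sv_bracket (e c) (sv_bracket (e a) (e b)) = 0"
proof -
  have cubic': "p * (144 * (p + r) ^ 3) + (q * (144 * (p + q) ^ 3) + r * (144 * (q + r) ^ 3)) =
      p * (144 * (p + q) ^ 3) + (q * (144 * (q + r) ^ 3) + r * (144 * (p + r) ^ 3))"
    if "p + (q + r) = 0" for p q r :: complex
  proof -
    from that have p: "p = - (q + r)" by (simp add: add_eq_0_iff2)
    show ?thesis unfolding p by algebra
  qed
  note cubic = cubic'[of "of_int p" "of_int q" "of_int r" for p q r,
      unfolded of_int_add[symmetric] of_int_eq_0_iff, unfolded of_int_add]
  show ?thesis
    unfolding e_def
    by (cases a; cases b; cases c;
        simp add: sv_bracket_add_right sv_bracket_add_left if_distrib[of "sv_bracket _"]
          single_add[symmetric] single_uminus[symmetric] single_diff[symmetric] cong: if_cong;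
        auto intro!: poly_mapping_eqI cubic
          simp: lookup_add lookup_single when_def field_simps)
qed

lemma sv_jacobi:
  "sv_bracket x (sv_bracket y z) + sv_bracket y (sv_bracket z x) + sv_bracket z (sv_bracket x y) = 0"
proof -
  define J where "J x y z = sv_bracket x (sv_bracket y z) + sv_bracket y (sv_bracket z x) +
    sv_bracket z (sv_bracket x y)" for x y z
  note bilinear = sv_bracket_add_left sv_bracket_add_right
    sv_bracket_scale_left sv_bracket_scale_right
  have zero: "J 0 y z = 0" "J x 0 z = 0" "J x y 0 = 0" for x y z
    by (simp_all add: J_def)
  have add: "J (x + x') y z = J x y z + J x' y z" "J x (y + y') z = J x y z + J x y' z"
    "J x y (z + z') = J x y z + J x y z'" for x x' y y' z z'
    by (simp_all add: J_def bilinear)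
  have scale: "J (sv_scale s x) (sv_scale t y) (sv_scale u z) = sv_scale (s * t * u) (J x y z)"
    for s t u x y z
    by (simp add: J_def bilinear sv_vs.scale_right_distrib mult_ac)
  have basis: "J (Poly_Mapping.single a s) (Poly_Mapping.single b t) (Poly_Mapping.single c u) = 0"
    for a b c s t u
    using scale[of s "Poly_Mapping.single a 1" t "Poly_Mapping.single b 1" u
        "Poly_Mapping.single c 1"] sv_jacobi_basis[of a b c]
    by (simp add: J_def del: sv_bracket_single)
  have two: "J (Poly_Mapping.single a s) (Poly_Mapping.single b t) z = 0" for a b s t z
    by (induction z rule: sv_induct) (simp_all add: zero add basis)
  have one: "J (Poly_Mapping.single a s) y z = 0" for a s y z
    by (induction y rule: sv_induct) (simp_all add: zero add two)
  have "J x y z = 0"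
    by (induction x rule: sv_induct) (simp_all add: zero add one)
  then show ?thesis by (simp add: J_def)
qed

lemma lie_algebra_sv: "lie_algebra sv_scale sv_bracket"
  by (intro lie_algebra.intro vector_space_sv lie_algebra_axioms.intro)
     (rule sv_bracket_add_left sv_bracket_add_right sv_bracket_scale_left
        sv_bracket_scale_right sv_bracket_self sv_jacobi)+

interpretation sv: lie_algebra sv_scale sv_bracket
  by (rule lie_algebra_sv)

lemma sv_brackets:
  defines "L \<equiv> \<lambda>m. Poly_Mapping.single (Lb m) 1"
    and "M \<equiv> \<lambda>m. Poly_Mapping.single (Mb m) 1"
    and "Y \<equiv> \<lambda>m. Poly_Mapping.single (Yb m) 1"
    and "C \<equiv> Poly_Mapping.single Cb 1"
  shows "sv_bracket (L m) (L n) = sv_scale (of_int (n - m)) (L (n + m)) +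
      (if m + n = 0 then sv_scale (of_int (n ^ 3 - n) / 12) C else 0)"
    and "sv_bracket (L m) (M n) = sv_scale (of_int n) (M (n + m))"
    and "sv_bracket (L m) (Y n) = sv_scale (of_int n + (1 - of_int m) / 2) (Y (m + n))"
    and "sv_bracket (Y m) (Y n) = sv_scale (of_int (n - m)) (M (m + n + 1))"
    and "sv_bracket (M m) (M n) = 0"
    and "sv_bracket (M m) (Y n) = 0"
    and "sv_bracket C x = 0" "sv_bracket x C = 0"
proof -
  show "sv_bracket C x = 0"
    by (induction x rule: sv_induct) (simp_all add: C_def sv_bracket_add_right)
  then show "sv_bracket x C = 0"
    using sv_bracket_swap[of x C] by simp
qed (simp_all add: L_def M_def Y_def C_def add.commute)

end

(* This holds for every perfect Lie algebra in which N - 1 is invertible.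
   Expanding ad [x_1, ..., x_(N-1)] into products of N - 1 adjoint maps shows that an N-derivation phi
   normalises ad g: for every w there is psi w with [phi, ad w] = ad (psi w).  Modulo the centre,
   psi is a derivation, and f = psi - phi lies in the centroid by antisymmetry of the bracket.
   As an N-derivation in the centroid, f satisfies N f = f on N-fold brackets modulo the centre,
   so f is central-valued and phi is a derivation. *)
theory Submission
  imports Defs
begin

context lie_algebra
begin

section \<open>Bilinearity, antisymmetry and Jacobi identity\<close>

lemma bracket_zero_left [simp]: "bracket 0 x = 0"
  using bracket_add_left[of 0 0 x] by simp

lemma bracket_zero_right [simp]: "bracket x 0 = 0"
  using bracket_add_right[of x 0 0] by simp

lemma bracket_minus_left: "bracket (- x) y = - bracket x y"
  using bracket_add_left[of "- x" x y] by (simp add: eq_neg_iff_add_eq_0)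

lemma bracket_minus_right: "bracket x (- y) = - bracket x y"
  using bracket_add_right[of x "- y" y] by (simp add: eq_neg_iff_add_eq_0)

lemma bracket_diff_left: "bracket (x - y) z = bracket x z - bracket y z"
  using bracket_add_left[of x "- y" z] by (simp add: bracket_minus_left)

lemma bracket_diff_right: "bracket x (y - z) = bracket x y - bracket x z"
  using bracket_add_right[of x y "- z"] by (simp add: bracket_minus_right)

lemmas bracket_linear = bracket_add_left bracket_add_right bracket_diff_left bracket_diff_right
  bracket_scale_left bracket_scale_right

lemma bracket_swap: "bracket y x = - bracket x y"
proof -
  have "bracket x x + bracket y x + (bracket x y + bracket y y) = 0"
    using bracket_self[of "x + y"] by (simp only: bracket_add_left bracket_add_right)
  then have "bracket y x + bracket x y = 0"
    by (simp add: bracket_self)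
  then show ?thesis
    by (simp only: eq_neg_iff_add_eq_0)
qed

text \<open>Jacobi identity in the form ad [x, y] = ad x ad y - ad y ad x.\<close>

lemma bracket_bracket_left:
  "bracket (bracket x y) z = bracket x (bracket y z) - bracket y (bracket x z)"
proof -
  have "bracket z (bracket x y) = - bracket (bracket x y) z"
    by (rule bracket_swap)
  moreover have "bracket y (bracket z x) = - bracket y (bracket x z)"
    by (metis bracket_swap bracket_minus_right)
  ultimately show ?thesis
    using jacobi[of x y z] by (simp add: algebra_simps)
qed

section \<open>Leibniz rule on right-nested brackets\<close>

text \<open>Right-hand side of the \<open>N\<close>-derivation identity, in a recursive form suited
  to induction on the list.\<close>

primrec leibniz_sum :: "('v \<Rightarrow> 'v) \<Rightarrow> 'v list \<Rightarrow> 'v" where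
  "leibniz_sum f [] = 0"
| "leibniz_sum f (x # xs) = (if xs = [] then f x
     else bracket (f x) (iterated_bracket xs) + bracket x (leibniz_sum f xs))"

lemma bracket_sum_right: "bracket x (\<Sum>i\<in>A. g i) = (\<Sum>i\<in>A. bracket x (g i))"
  by (induction A rule: infinite_finite_induct) (simp_all add: bracket_add_right)

lemma leibniz_sum_eq:
  "(\<Sum>i<length xs. iterated_bracket (xs[i := f (xs ! i)])) = leibniz_sum f xs"
proof (induction xs)
  case (Cons x xs)
  show ?case
  proof (cases "xs = []")
    case False
    then have "(\<Sum>i<length (x # xs). iterated_bracket ((x # xs)[i := f ((x # xs) ! i)])) =
        bracket (f x) (iterated_bracket xs) +
        (\<Sum>i<length xs. bracket x (iterated_bracket (xs[i := f (xs ! i)])))"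
      by (simp add: sum.lessThan_Suc_shift del: sum.lessThan_Suc)
    with False show ?thesis
      by (simp add: Cons.IH flip: bracket_sum_right)
  qed simp
qed simp

lemma is_N_derivation_iff:
  "is_N_derivation N f \<longleftrightarrow> Vector_Spaces.linear scale scale f \<and>
     (\<forall>xs. length xs = N \<longrightarrow> f (iterated_bracket xs) = leibniz_sum f xs)"
  unfolding is_N_derivation_def using leibniz_sum_eq by (metis (no_types, lifting))

lemma derivation_iterated_bracket:
  assumes "is_derivation f"
  shows "f (iterated_bracket xs) = leibniz_sum f xs"
proof -
  have "f 0 = 0"
    using assms module_hom.zero by (auto simp: is_derivation_def linear_iff_module_hom)
  with assms show ?thesis
    by (induction xs) (auto simp: is_derivation_def)
qed

lemma leibniz_sum_diff: "leibniz_sum (\<lambda>x. f x - g x) xs = leibniz_sum f xs - leibniz_sum g xs"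
  by (induction xs) (auto simp: bracket_linear)

section \<open>Leibniz rule for a nested block in the left argument\<close>

abbreviation bracket_word :: "'v list \<Rightarrow> 'v \<Rightarrow> 'v" where
  "bracket_word as u \<equiv> foldr bracket as u"

text \<open>The \<open>\<epsilon>\<close>-part of \<open>bracket_word\<close> over the dual numbers, where each letter \<open>a\<close> is
  replaced by \<open>a + \<epsilon> f a\<close> and \<open>u\<close> by \<open>u + \<epsilon> u'\<close>.\<close>

primrec leibniz_word :: "('v \<Rightarrow> 'v) \<Rightarrow> 'v list \<Rightarrow> 'v \<Rightarrow> 'v \<Rightarrow> 'v" where
  "leibniz_word f [] u u' = u'"
| "leibniz_word f (a # as) u u' =
     bracket (f a) (bracket_word as u) + bracket a (leibniz_word f as u u')"

lemma bracket_word_diff: "bracket_word as (u - v) = bracket_word as u - bracket_word as v"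
  by (induction as) (simp_all add: bracket_linear)

lemma leibniz_word_diff:
  "leibniz_word f as (u - v) (u' - v') = leibniz_word f as u u' - leibniz_word f as v v'"
  by (induction as) (simp_all add: bracket_linear bracket_word_diff)

lemma leibniz_word_append:
  "leibniz_word f (as @ bs) u u' = leibniz_word f as (bracket_word bs u) (leibniz_word f bs u u')"
  by (induction as) simp_all

lemma iterated_bracket_append:
  "bs \<noteq> [] \<Longrightarrow> iterated_bracket (as @ bs) = bracket_word as (iterated_bracket bs)"
  by (induction as) simp_all

lemma leibniz_sum_append:
  "bs \<noteq> [] \<Longrightarrow> leibniz_sum f (as @ bs) = leibniz_word f as (iterated_bracket bs) (leibniz_sum f bs)"
  by (induction as) (simp_all add: iterated_bracket_append)

text \<open>The definition speaks only of right-nested brackets. Jacobi dissolves the block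
  \<open>bs\<close> one letter at a time without changing the number of letters. The prefix
  \<open>as\<close> is carried along for the induction.\<close>

lemma N_derivation_bracket_word:
  assumes "is_N_derivation N f" "bs \<noteq> []" "ds \<noteq> []" "length as + length bs + length ds = N"
  shows "f (bracket_word as (bracket (iterated_bracket bs) (iterated_bracket ds))) =
    leibniz_word f as (bracket (iterated_bracket bs) (iterated_bracket ds))
      (bracket (leibniz_sum f bs) (iterated_bracket ds) +
       bracket (iterated_bracket bs) (leibniz_sum f ds))"
  using assms(2-)
proof (induction bs arbitrary: as ds)
  case (Cons b bs)
  have lin: "Vector_Spaces.linear scale scale f"
    and der: "\<And>xs. length xs = N \<Longrightarrow> f (iterated_bracket xs) = leibniz_sum f xs"
    using assms(1) by (auto simp: is_N_derivation_iff)
  interpret Vector_Spaces.linear scale scale f by (rule lin)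
  show ?case
  proof (cases "bs = []")
    case True
    then show ?thesis
      using der[of "as @ b # ds"] Cons.prems
      by (simp add: iterated_bracket_append leibniz_sum_append)
  next
    case False
    define c where "c = iterated_bracket bs"
    define c' where "c' = leibniz_sum f bs"
    define d where "d = iterated_bracket ds"
    define d' where "d' = leibniz_sum f ds"
    \<comment> \<open>In the first term \<open>b\<close> joins the prefix \<open>as\<close>, in the
      second it joins \<open>ds\<close>. The total length stays \<open>N\<close>, so the induction
      hypothesis covers both.\<close>
    have eq: "bracket (bracket b c) d = bracket b (bracket c d) - bracket c (bracket b d)"
      by (rule bracket_bracket_left)
    \<comment> \<open>The same Jacobi expansion, for the \<epsilon>-parts.\<close>
    have eq': "bracket (bracket (f b) c + bracket b c') d + bracket (bracket b c) d' =
        (bracket (f b) (bracket c d) + bracket b (bracket c' d + bracket c d')) -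
        (bracket c' (bracket b d) + bracket c (bracket (f b) d + bracket b d'))"
      by (simp add: bracket_bracket_left bracket_linear)
    have left: "f (bracket_word as (bracket b (bracket c d))) =
        leibniz_word f as (bracket b (bracket c d))
          (bracket (f b) (bracket c d) + bracket b (bracket c' d + bracket c d'))"
      using Cons.IH[of ds "as @ [b]"] Cons.prems False
      by (simp add: c_def c'_def d_def d'_def leibniz_word_append)
    have right: "f (bracket_word as (bracket c (bracket b d))) =
        leibniz_word f as (bracket c (bracket b d))
          (bracket c' (bracket b d) + bracket c (bracket (f b) d + bracket b d'))"
      using Cons.IH[of "b # ds" as] Cons.prems False
      by (simp add: c_def c'_def d_def d'_def)
    have "f (bracket_word as (bracket (bracket b c) d)) =
        leibniz_word f as (bracket (bracket b c) d)
          (bracket (bracket (f b) c + bracket b c') d + bracket (bracket b c) d')"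
      unfolding eq eq' bracket_word_diff leibniz_word_diff
      by (simp add: diff left right)
    with False show ?thesis
      by (simp add: c_def c'_def d_def d'_def)
  qed
qed simp

section \<open>Perfect Lie algebras\<close>

text \<open>By induction, the right factor of any bracket \<open>bracket x y\<close> is a
  combination of \<open>n\<close>-fold brackets, and bracketing those with \<open>x\<close> gives
  \<open>Suc n\<close>-fold ones.\<close>

lemma span_iterated_brackets:
  assumes perfect: "span {bracket x y |x y. True} = UNIV" and "n > 0"
  shows "span {iterated_bracket xs |xs. length xs = n} = UNIV"
  using \<open>n > 0\<close>
proof (induction n rule: nat_induct_non_zero)
  case 1
  have "iterated_bracket [x] = x" for x
    by simp
  then have "{iterated_bracket xs |xs. length xs = 1} = UNIV"
    by (metis (mono_tags, lifting) One_nat_def UNIV_eq_I length_Cons list.size(3) mem_Collect_eq)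
  then show ?case
    by simp
next
  case (Suc n)
  let ?S = "{iterated_bracket xs |xs. length xs = Suc n}"
  have "bracket x y \<in> span ?S" for x y
  proof -
    have "y \<in> span {iterated_bracket xs |xs. length xs = n}"
      using Suc.IH by simp
    then show ?thesis
    proof (induction rule: span_induct_alt)
      case base
      then show ?case by (simp add: span_zero)
    next
      case (step c z y)
      then obtain xs where xs: "z = iterated_bracket xs" "length xs = n"
        by auto
      with Suc.hyps have "bracket x z = iterated_bracket (x # xs)"
        by auto
      with xs have "bracket x z \<in> ?S"
        by (metis (mono_tags, lifting) length_Cons mem_Collect_eq)
      with step show ?case
        by (simp add: bracket_linear span_add span_scale span_base)
    qed
  qed
  then have "span {bracket x y |x y. True} \<subseteq> span ?S"
    by (intro span_minimal) auto
  with perfect show ?case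
    by auto
qed

text \<open>Equality of \<open>bracket u\<close> and \<open>bracket v\<close> is equality of
  \<open>u\<close> and \<open>v\<close> modulo the centre. All congruences modulo the centre below
  are written this way.\<close>

lemma ad_bracket_cong: "bracket u = bracket v \<Longrightarrow> bracket (bracket x u) = bracket (bracket x v)"
  by (rule ext) (simp add: bracket_bracket_left)

theorem N_derivation_is_derivation:
  assumes perfect: "span {bracket x y |x y. True} = UNIV"
    and N: "N \<ge> 2" "of_nat N \<noteq> (1 :: 'k)" and \<phi>: "is_N_derivation N \<phi>"
  shows "is_derivation \<phi>"
proof -
  have lin: "Vector_Spaces.linear scale scale \<phi>"
    and der: "\<And>xs. length xs = N \<Longrightarrow> \<phi> (iterated_bracket xs) = leibniz_sum \<phi> xs"
    using \<phi> by (auto simp: is_N_derivation_iff)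
  interpret \<phi>: Vector_Spaces.linear scale scale \<phi> by (rule lin)
  note \<phi>_linear = \<phi>.add \<phi>.scale \<phi>.diff
  have "\<exists>u. \<forall>x. \<phi> (bracket w x) = bracket u x + bracket w (\<phi> x)" for w
  proof -
    \<comment> \<open>With \<open>N - 1\<close> letters spent on \<open>w\<close>, one slot remains
      for \<open>x\<close>. On such a bracket \<open>leibniz_sum \<phi> xs\<close> is the witness,
      and witnesses combine linearly.\<close>
    have "w \<in> span {iterated_bracket xs |xs. length xs = N - 1}"
      using span_iterated_brackets[OF perfect, of "N - 1"] N by simp
    then show ?thesis
    proof (induction rule: span_induct_alt)
      case base
      then show ?case by (auto simp: \<phi>_linear intro!: exI[of _ 0])
    next
      case (step c z y)
      then obtain u xs where u: "\<forall>x. \<phi> (bracket y x) = bracket u x + bracket y (\<phi> x)"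
        and xs: "z = iterated_bracket xs" "length xs = N - 1"
        by auto
      from xs N have "xs \<noteq> []" by auto
      then have "\<phi> (bracket z x) = bracket (leibniz_sum \<phi> xs) x + bracket z (\<phi> x)" for x
        using N_derivation_bracket_word[OF \<phi>, of xs "[x]" "[]"] xs N by simp
      with u show ?case
        by (intro exI[of _ "scale c (leibniz_sum \<phi> xs) + u"])
          (simp add: bracket_linear \<phi>_linear scale_right_distrib)
    qed
  qed
  then obtain \<psi> where \<psi>: "\<And>w x. \<phi> (bracket w x) = bracket (\<psi> w) x + bracket w (\<phi> x)"
    by metis
  define f where "f = (\<lambda>x. \<psi> x - \<phi> x)"
  \<comment> \<open>Expand both sides of
    \<open>\<phi> (bracket v w) = - \<phi> (bracket w v)\<close> by \<open>\<psi>\<close> and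
    compare.\<close>
  have f_swap: "bracket (f v) w = bracket v (f w)" for v w
  proof -
    have "\<phi> (bracket v w) = - \<phi> (bracket w v)"
      using \<phi>.neg[of "bracket w v"] by (simp add: bracket_swap[of v w])
    then show ?thesis
      using bracket_swap[of "\<psi> w" v] bracket_swap[of w "\<phi> v"]
      by (simp add: \<psi> f_def bracket_linear algebra_simps)
  qed
  \<comment> \<open>The commutator with \<open>\<phi>\<close> is a derivation on linear maps, and it
    sends ad w to ad (\<open>\<psi> w\<close>).\<close>
  have \<psi>_bracket: "bracket (\<psi> (bracket v w)) = bracket (bracket (\<psi> v) w + bracket v (\<psi> w))" for v w
  proof
    fix x
    have "bracket (\<psi> (bracket v w)) x = \<phi> (bracket (bracket v w) x) - bracket (bracket v w) (\<phi> x)"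
      by (simp add: \<psi>)
    also have "\<dots> = bracket (bracket (\<psi> v) w + bracket v (\<psi> w)) x"
      by (simp only: bracket_bracket_left \<psi> \<phi>_linear bracket_linear) (simp add: algebra_simps)
    finally show "bracket (\<psi> (bracket v w)) x = bracket (bracket (\<psi> v) w + bracket v (\<psi> w)) x" .
  qed
  have f_bracket: "bracket (f (bracket v w)) = bracket (bracket v (f w))" for v w
  proof
    fix x
    \<comment> \<open>The first two terms together are central by
      \<open>\<psi>_bracket\<close>.\<close>
    have "f (bracket v w) = \<psi> (bracket v w) - (bracket (\<psi> v) w + bracket v (\<psi> w)) + bracket v (f w)"
      by (simp add: f_def \<psi> bracket_linear)
    then show "bracket (f (bracket v w)) x = bracket (bracket v (f w)) x"
      using fun_cong[OF \<psi>_bracket[of v w], of x] by (simp add: bracket_linear)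
  qed
  have \<psi>_iterated: "bracket (\<psi> (iterated_bracket xs)) = bracket (leibniz_sum \<psi> xs)" if "xs \<noteq> []" for xs
    using that
  proof (induction xs)
    case (Cons x xs)
    then show ?case
      using ad_bracket_cong[of "\<psi> (iterated_bracket xs)" "leibniz_sum \<psi> xs" x]
      by (auto simp: \<psi>_bracket bracket_linear fun_eq_iff)
  qed simp
  \<comment> \<open>Modulo the centre \<open>f\<close> can be pulled out of any entry, so each of
    the \<open>length xs\<close> summands equals \<open>f (iterated_bracket xs)\<close>.\<close>
  have f_iterated: "bracket (leibniz_sum f xs) x =
      scale (of_nat (length xs)) (bracket (f (iterated_bracket xs)) x)" if "xs \<noteq> []" for xs x
    using that
  proof (induction xs arbitrary: x)
    case (Cons a xs)
    show ?case
    proof (cases "xs = []")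
      case False
      let ?P = "iterated_bracket xs"
      have ad: "bracket (leibniz_sum f xs) = bracket (scale (of_nat (length xs)) (f ?P))"
        using Cons.IH[OF False] by (auto simp: bracket_linear)
      have "bracket (leibniz_sum f (a # xs)) x =
          bracket (bracket a (f ?P)) x + scale (of_nat (length xs)) (bracket (bracket a (f ?P)) x)"
        using False fun_cong[OF ad_bracket_cong[OF ad, of a], of x]
        by (simp add: bracket_linear f_swap)
      then show ?thesis
        using False by (simp add: f_bracket scale_left_distrib)
    qed simp
  qed simp
  have "\<phi> (bracket w x) = bracket (\<phi> w) x + bracket w (\<phi> x)" for w x
  proof -
    \<comment> \<open>The derivation identity is linear in \<open>w\<close>, so it suffices to show
      \<open>f z\<close> central for \<open>N\<close>-fold brackets \<open>z\<close>.\<close>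
    have "w \<in> span {iterated_bracket xs |xs. length xs = N}"
      using span_iterated_brackets[OF perfect, of N] N by simp
    then show ?thesis
    proof (induction rule: span_induct_alt)
      case base
      then show ?case by (simp add: \<phi>_linear)
    next
      case (step c z y)
      then obtain xs where xs: "z = iterated_bracket xs" "length xs = N"
        by auto
      with N have "xs \<noteq> []" by auto
      have "leibniz_sum f xs = leibniz_sum \<psi> xs - \<phi> z"
        by (simp add: f_def leibniz_sum_diff der xs)
      \<comment> \<open>The left side is \<open>leibniz_sum f xs\<close> by
        \<open>f_iterated\<close>, the right side is the same element by
        \<open>\<psi>_iterated\<close>, each bracketed with \<open>x\<close>.\<close>
      then have "scale (of_nat N) (bracket (f z) x) = bracket (f z) x"
        using f_iterated[OF \<open>xs \<noteq> []\<close>, of x] \<psi>_iterated[OF \<open>xs \<noteq> []\<close>] xs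
        by (simp add: f_def bracket_linear)
      then have "scale (of_nat N - 1) (bracket (f z) x) = 0"
        by (simp add: scale_left_diff_distrib)
      with N have "bracket (f z) x = 0"
        by simp
      then have "bracket (\<psi> z) x = bracket (\<phi> z) x"
        by (simp add: f_def bracket_linear)
      with step.IH show ?case
        by (simp add: \<phi>_linear bracket_linear \<psi> scale_right_distrib)
    qed
  qed
  with lin show ?thesis
    by (simp add: is_derivation_def)
qed

corollary perfect_Der_N_eq_Der:
  assumes "span {bracket x y |x y. True} = UNIV" and "N \<ge> 2" "of_nat N \<noteq> (1 :: 'k)"
  shows "Der_N N = Der"
proof -
  have "is_N_derivation N f" if "is_derivation f" for f
    unfolding is_N_derivation_iff
    using that derivation_iterated_bracket[OF that] by (simp only: is_derivation_def) blast
  then show ?thesis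
    using N_derivation_is_derivation[OF assms] unfolding Der_N_def Der_def by blast
qed

end

section \<open>Perfectness of the Schroedinger-Virasoro algebra\<close>

text \<open>ad \<open>L_0\<close> multiplies each of \<open>L\<close>, \<open>M\<close>,
  \<open>Y\<close> by its index, which yields all of them of nonzero index. Only \<open>L_0\<close>,
  \<open>M_0\<close> and \<open>C\<close> need other brackets.\<close>

lemma sv_perfect: "sv_vs.span {sv_bracket x y |x y. True} = UNIV"
proof -
  let ?S = "sv_vs.span {sv_bracket x y |x y. True}"
  let ?e = "\<lambda>a. Poly_Mapping.single a (1 :: complex)"
  have br: "sv_bracket x y \<in> ?S" for x y
    by (rule sv_vs.span_base) auto
  have cancel: "?e a \<in> ?S" if "Poly_Mapping.single a c \<in> ?S" "c \<noteq> 0" for a c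
    using sv_vs.span_scale[OF that(1), of "inverse c"] that(2) by simp
  have L: "?e (Lb n) \<in> ?S" for n
  proof (cases "n = 0")
    case True
    \<comment> \<open>No \<open>Cb\<close> term arises, as n^3 - n vanishes at n = -1.\<close>
    have "Poly_Mapping.single (Lb 0) (-2) \<in> ?S"
      using br[of "?e (Lb 1)" "?e (Lb (-1))"] by simp
    from cancel[OF this] True show ?thesis by simp
  next
    case False
    then have "Poly_Mapping.single (Lb n) (of_int n) \<in> ?S"
      using br[of "?e (Lb 0)" "?e (Lb n)"] by simp
    from cancel[OF this] False show ?thesis by simp
  qed
  have M: "?e (Mb n) \<in> ?S" for n
  proof (cases "n = 0")
    case True
    have "Poly_Mapping.single (Mb 0) (-1) \<in> ?S"
      using br[of "?e (Lb 1)" "?e (Mb (-1))"] by simp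
    from cancel[OF this] True show ?thesis by simp
  next
    case False
    then have "Poly_Mapping.single (Mb n) (of_int n) \<in> ?S"
      using br[of "?e (Lb 0)" "?e (Mb n)"] by simp
    from cancel[OF this] False show ?thesis by simp
  qed
  have Y: "?e (Yb n) \<in> ?S" for n
  proof -
    \<comment> \<open>The half-integer index is never 0, its numerator being odd.\<close>
    have "(of_int n + 1 / 2 :: complex) = of_int (2 * n + 1) / 2"
      by (simp add: field_simps)
    moreover have "2 * n + 1 \<noteq> 0"
      by presburger
    ultimately have "(of_int n + 1 / 2 :: complex) \<noteq> 0"
      by (metis divide_eq_0_iff of_int_eq_0_iff zero_neq_numeral)
    moreover have "Poly_Mapping.single (Yb n) (of_int n + 1 / 2) \<in> ?S"
      using br[of "?e (Lb 0)" "?e (Yb n)"] by simp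
    ultimately show ?thesis
      using cancel by blast
  qed
  have C: "?e Cb \<in> ?S"
  proof -
    \<comment> \<open>At n = -2 the central coefficient is (n^3 - n)/12 = -1/2.\<close>
    have "Poly_Mapping.single (Lb 0) (-4) + Poly_Mapping.single Cb (- 1 / 2) \<in> ?S"
      using br[of "?e (Lb 2)" "?e (Lb (-2))"] by simp
    moreover have "Poly_Mapping.single (Lb 0) (-4) \<in> ?S"
      using sv_vs.span_scale[OF L[of 0], of "-4"] by simp
    ultimately have "Poly_Mapping.single Cb (- 1 / 2) \<in> ?S"
      using sv_vs.span_diff by fastforce
    then show ?thesis
      by (rule cancel) simp
  qed
  have "?e a \<in> ?S" for a
    using L M Y C by (cases a) auto
  then have single: "Poly_Mapping.single a c \<in> ?S" for a c
    using sv_vs.span_scale[of "?e a" _ c] by simp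
  have "x \<in> ?S" for x
    by (induction x rule: sv_induct) (rule single sv_vs.span_zero sv_vs.span_add | assumption)+
  then show ?thesis
    by auto
qed

theorem corollary4p1p1:
  fixes N :: nat
  assumes "N \<ge> 3"
  shows "sv.Der_N N = sv.Der"
proof -
  have "of_nat N \<noteq> (1 :: complex)"
    using assms by simp
  with assms show ?thesis
    by (intro sv.perfect_Der_N_eq_Der sv_perfect) simp_all
qed

end
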